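(* Let $k\ge 2$ be a positive integer, let $p$ be a prime such that $p\equiv 1 \pmod k$, and let $r\in\mathbb{Z}_p^*$ have order $k$. Then $\kappa(X(k,p;r))=k$.
   Context: Graphs are finite, simple and undirected. $\mathbb{Z}_n$ is the ring of residue classes modulo $n$ and $\mathbb{Z}_n^*$ its group of units. Hamilton compression: let $X$ be a graph of order $N$. A Hamilton cycle $C=v_0,v_1,\ldots,v_{N-1},v_0$ in $X$ is $\ell$-symmetric (where $\ell$ is a positive divisor of $N$) if there exists an automorphism $\alpha$ of $X$ such that $\alpha(v_i)=v_{i+N/\ell}$ for each $i\in\mathbb{Z}_N$. The compression factor $\kappa(X,C)$ is the maximum $\ell$ for which $C$ is $\ell$-symmetric. The Hamilton compression is $\kappa(X)=\max\{\kappa(X,C)\mid C \text{ is a Hamilton cycle in } X\}$, and $\kappa(X)=0$ if $X$ has no Hamilton cycle. The graph $X(m,n;r)$: for $m\ge2$ and $r\in\mathbb{Z}_n^*$ of order $m$, the graph $X(m,n;r)$ has vertex set $\{v_i^j : i\in\mathbb{Z}_m,\ j\in\mathbb{Z}_n\}$ (subscript and superscript are both indices), and its edges are given by the adjacencies $v_i^j\sim v_i^{j+r^i}$ and $v_i^j\sim v_{i+1}^j$ for all $i\in\mathbb{Z}_m$, $j\in\mathbb{Z}_n$. *)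

theory Defs
  imports "HOL-Number_Theory.Number_Theory"
begin

record 'a ugraph =
  verts :: "'a set"
  edges :: "'a set set"

definition simple_graph :: "'a ugraph \<Rightarrow> bool" where
  "simple_graph X \<longleftrightarrow> finite (verts X) \<and> (\<forall>e\<in>edges X. e \<subseteq> verts X \<and> card e = 2)"

text \<open>The values of an automorphism outside the vertex set are irrelevant.\<close>
definition automorphism :: "'a ugraph \<Rightarrow> ('a \<Rightarrow> 'a) \<Rightarrow> bool" where
  "automorphism X \<alpha> \<longleftrightarrow> bij_betw \<alpha> (verts X) (verts X) \<and>
     (\<forall>u\<in>verts X. \<forall>v\<in>verts X. {u, v} \<in> edges X \<longleftrightarrow> {\<alpha> u, \<alpha> v} \<in> edges X)"

text \<open>The list \<open>[v\<^sub>0, \<dots>, v\<^bsub>N-1\<^esub>]\<close> stands for the closed walk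
  \<open>v\<^sub>0, \<dots>, v\<^bsub>N-1\<^esub>, v\<^sub>0\<close>. A cycle has at least three vertices.\<close>
definition hamilton_cycle :: "'a ugraph \<Rightarrow> 'a list \<Rightarrow> bool" where
  "hamilton_cycle X C \<longleftrightarrow> distinct C \<and> set C = verts X \<and> length C \<ge> 3 \<and>
     (\<forall>i<length C. {C ! i, C ! ((i + 1) mod length C)} \<in> edges X)"

definition symmetric_cycle :: "'a ugraph \<Rightarrow> 'a list \<Rightarrow> nat \<Rightarrow> bool" where
  "symmetric_cycle X C l \<longleftrightarrow> l > 0 \<and> l dvd length C \<and>
     (\<exists>\<alpha>. automorphism X \<alpha> \<and>
        (\<forall>i<length C. \<alpha> (C ! i) = C ! ((i + length C div l) mod length C)))"

definition compression_factor :: "'a ugraph \<Rightarrow> 'a list \<Rightarrow> nat" where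
  "compression_factor X C = Max {l. symmetric_cycle X C l}"

definition hamilton_compression :: "'a ugraph \<Rightarrow> nat" where
  "hamilton_compression X =
     (if \<exists>C. hamilton_cycle X C
      then Max {compression_factor X C | C. hamilton_cycle X C} else 0)"

text \<open>The vertex \<open>v\<^sub>i\<^sup>j\<close> is the pair \<open>(i, j)\<close>, residue classes being represented by
  \<open>{0..<m}\<close> and \<open>{0..<n}\<close>; \<open>r\<close> is any representative of an element of order \<open>m\<close>
  in the group of units modulo \<open>n\<close>.\<close>
definition X_graph :: "nat \<Rightarrow> nat \<Rightarrow> nat \<Rightarrow> (nat \<times> nat) ugraph" where
  "X_graph m n r = \<lparr>
     verts = {0..<m} \<times> {0..<n},
     edges = {{(i, j), (i, (j + r ^ i) mod n)} | i j. i < m \<and> j < n}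
           \<union> {{(i, j), ((i + 1) mod m, j)} | i j. i < m \<and> j < n}\<rparr>"

lemma simple_graph_X_graph:
  assumes "m \<ge> 2" "n \<ge> 2" "coprime r n"
  shows "simple_graph (X_graph m n r)"
proof -
  have 1: "(j + r ^ i) mod n \<noteq> j" if "j < n" for i j
  proof
    assume "(j + r ^ i) mod n = j"
    then have "[j + r ^ i = j + 0] (mod n)"
      using that by (simp add: cong_def)
    then have "n dvd r ^ i"
      by (simp only: cong_add_lcancel_nat cong_0_iff)
    moreover have "coprime (r ^ i) n"
      using assms(3) by simp
    ultimately show False
      using assms(2) by (metis coprime_absorb_right is_unit_gcd nat_dvd_1_iff_1 One_nat_def
          Suc_1 not_less_eq_eq order_refl)
  qed
  have 2: "(i + 1) mod m \<noteq> i" if "i < m" for i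
    using that assms(1) by (cases "i + 1 = m") auto
  show ?thesis
    using assms 1 2 unfolding simple_graph_def X_graph_def
    by (auto simp: card_2_iff doubleton_eq_iff) metis+
qed

end

theory Submission
  imports Defs "HOL-Algebra.Sylow" "HOL-Combinatorics.Cycles"
begin

text \<open>
Write \<open>X\<close> for \<open>X(k,p;r)\<close>, a graph with \<open>k p\<close> vertices in \<open>k\<close> layers of size \<open>p\<close>; note that \<open>k < p\<close>.

Lower bound (\<open>exists_symmetric_hamilton_cycle\<close>). Each layer has a Hamilton path with steps
\<open>r ^ i\<close>. With a suitable starting point, these paths are linked by edges between successive
layers to a Hamilton cycle that the automorphism \<open>(i, j) \<mapsto> (i + 1, r * j)\<close> rotates by \<open>p\<close>
steps, so that the cycle is \<open>k\<close>-symmetric.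

Upper bound (\<open>symmetry_order_le\<close>). If a Hamilton cycle is \<open>l\<close>-symmetric, then \<open>l\<close> divides \<open>k p\<close>; it is
therefore enough that \<open>p\<close> does not divide \<open>l\<close> (\<open>prime_not_dvd_symmetry\<close>). Suppose that it does. Then some
automorphism of order \<open>p\<close> rotates the cycle by \<open>k\<close> steps. If this automorphism is a power of
the rotation \<open>(i, j) \<mapsto> (i, j + 1)\<close>, it preserves the layers, so that \<open>k\<close> successive vertices of the
cycle lie in the \<open>k\<close> different layers; the cycle then never uses an edge inside a layer
and cannot change the second component (\<open>no_layer_preserving_shift\<close>).

The general case reduces to this one by conjugation. An automorphism of \<open>p\<close>-power
order that fixes a vertex is trivial, as \<open>X\<close> is connected and its valency is less than \<open>p\<close>; the only
exception is the triangular prism (\<open>k = 2\<close>, \<open>p = 3\<close>), for which the complement serves instead. As there are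
fewer than \<open>p\<^sup>2\<close> vertices, Sylow's existence theorem shows that \<open>p\<^sup>2\<close> does not
divide the order of the automorphism group (\<open>prime_square_not_dvd_order_aut_group\<close>). Hence
every element of order \<open>p\<close> is conjugate to a power of the rotation
(\<open>conjugate_to_power_of_prime_order\<close>).
\<close>

section \<open>Elements of prime order in a finite group\<close>

lemma (in group) pow_multiple_eq_self:
  assumes "prime p" and a: "a \<in> carrier G" "a [^] (p::nat) = \<one>" and "\<not> p dvd d"
  shows "\<exists>u. a [^] (d * u :: nat) = a"
proof -
  have "coprime d p"
    using prime_imp_coprime[OF assms(1,4)] by (simp add: coprime_commute)
  then obtain u where "[d * u = 1] (mod p)"
    using cong_solve_coprime_nat by auto
  moreover have "\<not> p dvd 1"
    using assms(1) not_prime_unit by blast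
  ultimately have "1 < p \<and> (d * u) mod p = 1"
    using assms(1) prime_gt_1_nat by (simp add: cong_def)
  then have "d * u = p * (d * u div p) + 1"
    by (metis mult_div_mod_eq)
  then have "a [^] (d * u) = (a [^] p) [^] (d * u div p) \<otimes> a"
    using a by (metis nat_pow_mult nat_pow_pow nat_pow_eone)
  then have "a [^] (d * u) = a" using a by simp
  then show ?thesis by blast
qed

text \<open>This is the part of Sylow's second theorem for Sylow subgroups of order \<open>p\<close> that is needed
below. Let \<open>A\<close> and \<open>B\<close> be the subgroups generated by \<open>a\<close> and \<open>b\<close>. The group is partitioned
into double cosets \<open>B x A\<close>. If no conjugate of \<open>b\<close> were a power of \<open>a\<close>, then
\<open>A\<close> and every conjugate of \<open>B\<close> would intersect trivially, so that all double cosets would have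
exactly \<open>p\<^sup>2\<close> elements and \<open>p\<^sup>2\<close> would divide the order of the group.\<close>
lemma (in group) conjugate_to_power_of_prime_order:
  assumes p: "prime p" and fin: "finite (carrier G)" and np2: "\<not> p\<^sup>2 dvd order G"
    and a: "a \<in> carrier G" "a [^] (p::nat) = \<one>" "a \<noteq> \<one>"
    and b: "b \<in> carrier G" "b [^] (p::nat) = \<one>"
  shows "\<exists>g\<in>carrier G. \<exists>t::nat. b \<otimes> g = g \<otimes> a [^] t"
proof (rule ccontr)
  assume "\<not> ?thesis"
  then have nconj: "b \<otimes> g \<noteq> g \<otimes> a [^] (t::nat)" if "g \<in> carrier G" for g t
    using that by blast
  have pow_mod: "c [^] n = c [^] (n mod p)" if "c \<in> carrier G" "c [^] p = \<one>" for c and n :: nat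
  proof -
    have "c [^] n = c [^] (p * (n div p) + n mod p)" by simp
    also have "\<dots> = (c [^] p) [^] (n div p) \<otimes> c [^] (n mod p)"
      using that by (metis nat_pow_mult nat_pow_pow)
    finally show ?thesis using that by simp
  qed
  have p0: "p > 0" using p prime_gt_0_nat by blast
  \<comment> \<open>The double coset \<open>B x A\<close>.\<close>
  define D where "D x = (\<lambda>(s, t). b [^] (s::nat) \<otimes> x \<otimes> a [^] (t::nat)) ` ({0..<p} \<times> {0..<p})" for x
  have D_all: "b [^] (s::nat) \<otimes> x \<otimes> a [^] (t::nat) \<in> D x" if "x \<in> carrier G" for s t x
    unfolding D_def
    using pow_mod[OF b, of s] pow_mod[OF a(1,2), of t] p0 by (intro image_eqI[of _ _ "(s mod p, t mod p)"]) auto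
  have D_trans: "D y \<subseteq> D x" if xy: "x \<in> carrier G" "y \<in> D x" for x y
  proof
    fix z assume "z \<in> D y"
    obtain s t where y: "y = b [^] (s::nat) \<otimes> x \<otimes> a [^] (t::nat)"
      using xy(2) unfolding D_def by auto
    obtain s' t' where "z = b [^] (s'::nat) \<otimes> y \<otimes> a [^] (t'::nat)"
      using \<open>z \<in> D y\<close> unfolding D_def by auto
    then have "z = (b [^] s' \<otimes> b [^] s) \<otimes> x \<otimes> (a [^] t \<otimes> a [^] t')"
      unfolding y using a(1) b(1) xy(1) by (simp add: m_assoc)
    then have "z = b [^] (s' + s) \<otimes> x \<otimes> a [^] (t + t')"
      using a(1) b(1) by (simp add: nat_pow_mult)
    then show "z \<in> D x" using D_all[OF xy(1)] by simp
  qed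
  have D_carrier: "D x \<subseteq> carrier G" if "x \<in> carrier G" for x
    using that a(1) b(1) unfolding D_def by auto
  have D_self: "x \<in> D x" if "x \<in> carrier G" for x
    using D_all[OF that, of 0 0] that by simp
  have D_sym: "x \<in> D y" if xy: "x \<in> carrier G" "y \<in> D x" for x y
  proof -
    obtain s t where st: "s < p" "t < p" and y: "y = b [^] (s::nat) \<otimes> x \<otimes> a [^] (t::nat)"
      using xy(2) unfolding D_def by auto
    have "b [^] (p - s) \<otimes> y \<otimes> a [^] (p - t) =
        (b [^] (p - s) \<otimes> b [^] s) \<otimes> x \<otimes> (a [^] t \<otimes> a [^] (p - t))"
      unfolding y using a(1) b(1) xy(1) by (simp add: m_assoc)
    also have "\<dots> = x"
      using a b st xy(1) by (simp add: nat_pow_mult)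
    finally show ?thesis
      using D_all[of y "p - s" "p - t"] D_carrier[OF xy(1)] xy(2) by auto
  qed
  have card_D: "card (D x) = p\<^sup>2" if x: "x \<in> carrier G" for x
  proof -
    have "s = s' \<and> t = t'"
      if st: "s < p" "t < p" "s' < p" "t' < p"
        and eq: "b [^] s \<otimes> x \<otimes> a [^] t = b [^] s' \<otimes> x \<otimes> a [^] t'" for s t s' t' :: nat
    proof -
      \<comment> \<open>The exponents \<open>s - s'\<close> and \<open>t' - t\<close>, shifted by \<open>p\<close> to avoid subtraction below zero.\<close>
      define d where "d = p - s' + s"
      define e where "e = t' + (p - t)"
      have "b [^] (p - s') \<otimes> (b [^] s \<otimes> x \<otimes> a [^] t) \<otimes> a [^] (p - t)
          = (b [^] (p - s') \<otimes> b [^] s) \<otimes> x \<otimes> (a [^] t \<otimes> a [^] (p - t))"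
        using a(1) b(1) x by (simp add: m_assoc)
      also have "\<dots> = b [^] d \<otimes> x"
        using a b st x by (simp add: nat_pow_mult d_def)
      finally have 1: "b [^] (p - s') \<otimes> (b [^] s \<otimes> x \<otimes> a [^] t) \<otimes> a [^] (p - t) = b [^] d \<otimes> x" .
      have "b [^] (p - s') \<otimes> (b [^] s' \<otimes> x \<otimes> a [^] t') \<otimes> a [^] (p - t)
          = (b [^] (p - s') \<otimes> b [^] s') \<otimes> x \<otimes> (a [^] t' \<otimes> a [^] (p - t))"
        using a(1) b(1) x by (simp add: m_assoc)
      also have "\<dots> = x \<otimes> a [^] e"
        using a b st x by (simp add: nat_pow_mult e_def)
      finally have de: "b [^] d \<otimes> x = x \<otimes> a [^] e" using 1 eq by simp
      have du: "b [^] (d * u) \<otimes> x = x \<otimes> a [^] (e * u)" for u :: nat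
      proof (induction u)
        case 0
        then show ?case using x by simp
      next
        case (Suc u)
        have "b [^] (d * Suc u) \<otimes> x = b [^] d \<otimes> (b [^] (d * u) \<otimes> x)"
          using b(1) x by (simp add: nat_pow_mult m_assoc[symmetric])
        also have "\<dots> = (b [^] d \<otimes> x) \<otimes> a [^] (e * u)"
          using Suc a(1) b(1) x by (simp add: m_assoc)
        also have "\<dots> = x \<otimes> a [^] (e * Suc u)"
          using de a(1) x by (simp add: nat_pow_mult m_assoc)
        finally show ?case .
      qed
      have "p dvd d"
      proof (rule ccontr)
        assume "\<not> p dvd d"
        then obtain u where "b [^] (d * u) = b"
          using pow_multiple_eq_self[OF p b] by blast
        then show False using du[of u] nconj[OF x] by simp
      qed
      then obtain q where q: "d = p * q" by blast
      then have "b [^] d = \<one>" using b by (simp flip: nat_pow_pow)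
      then have "a [^] e = \<one>" using de a(1) x by (simp add: r_cancel_one')
      have "p dvd e"
      proof (rule ccontr)
        assume "\<not> p dvd e"
        then obtain u where "a [^] (e * u) = a"
          using pow_multiple_eq_self[OF p a(1,2)] by blast
        then show False using \<open>a [^] e = \<one>\<close> a by (metis nat_pow_pow nat_pow_one)
      qed
      have "d < 2 * p" "e < 2 * p" "0 < d" "0 < e" using st unfolding d_def e_def by auto
      then have "d = p" "e = p"
        using \<open>p dvd d\<close> \<open>p dvd e\<close> by (auto elim!: dvdE)
      then show ?thesis using st unfolding d_def e_def by auto
    qed
    then have "inj_on (\<lambda>(s, t). b [^] (s::nat) \<otimes> x \<otimes> a [^] (t::nat)) ({0..<p} \<times> {0..<p})"
      by (auto simp: inj_on_def)
    then show ?thesis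
      unfolding D_def by (simp add: card_image power2_eq_square)
  qed
  have "p\<^sup>2 * card (D ` carrier G) = card (\<Union>(D ` carrier G))"
  proof (rule card_partition)
    show "finite (D ` carrier G)" using fin by simp
    show "finite (\<Union>(D ` carrier G))" using fin unfolding D_def by auto
    show "card c = p\<^sup>2" if "c \<in> D ` carrier G" for c using that card_D by auto
    show "c1 \<inter> c2 = {}" if c: "c1 \<in> D ` carrier G" "c2 \<in> D ` carrier G" "c1 \<noteq> c2" for c1 c2
    proof (rule ccontr)
      assume "c1 \<inter> c2 \<noteq> {}"
      then obtain x y z where xyz: "c1 = D x" "c2 = D y" "x \<in> carrier G" "y \<in> carrier G"
        "z \<in> D x" "z \<in> D y" using c by auto
      then have z: "z \<in> carrier G" using D_carrier by blast
      have "D x = D z" "D y = D z"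
        using D_trans D_sym xyz z by (meson subset_antisym)+
      then show False using c(3) xyz by simp
    qed
  qed
  moreover have "\<Union>(D ` carrier G) = carrier G"
    using D_carrier D_self by blast
  ultimately show False using np2 unfolding order_def by (metis dvd_triv_left)
qed

section \<open>Permutations of prime power order and small invariant sets\<close>

text \<open>The orbit of \<open>w\<close> stays in \<open>S\<close>, so it has fewer than \<open>p\<close> points; but its size divides \<open>p ^ n\<close>.\<close>
lemma fixes_each_point_of_small_invariant_set:
  assumes p: "prime (p::nat)" and pow: "h ^^ (p ^ n) = id"
    and S: "finite S" "card S < p" "h ` S \<subseteq> S" and w: "w \<in> S"
  shows "h w = w"
proof -
  define l where "l = least_power h w"
  have ret: "(h ^^ (p ^ n)) w = w" using pow by simp
  have p0: "p ^ n > 0" using p prime_gt_0_nat by simp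
  have l: "(h ^^ l) w = w" "l > 0"
    using least_powerI[OF ret p0] unfolding l_def by auto
  have "l dvd p ^ n" using least_power_minimal[OF ret] unfolding l_def by simp
  have mem: "(h ^^ i) w \<in> S" for i using S(3) w by (induction i) auto
  have "inj_on (\<lambda>i. (h ^^ i) w) {0..<l}"
  proof -
    have "False" if ij: "i < j" "j < l" "(h ^^ i) w = (h ^^ j) w" for i j
    proof -
      have "(h ^^ (l - j + i)) w = (h ^^ (l - j)) ((h ^^ i) w)" by (simp add: funpow_add)
      also have "\<dots> = (h ^^ (l - j + j)) w" unfolding ij(3) by (simp only: funpow_add o_apply)
      also have "\<dots> = w" using ij l by simp
      finally have "least_power h w \<le> l - j + i"
        using ij by (intro least_power_le) auto
      then show False using ij unfolding l_def by simp
    qed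
    then show ?thesis unfolding inj_on_def by (metis atLeastLessThan_iff linorder_neqE_nat)
  qed
  then have "l \<le> card S"
    using card_inj_on_le[of "\<lambda>i. (h ^^ i) w" "{0..<l}" S] mem S(1) by auto
  then have "l < p" using S(2) by simp
  obtain m where "l = p ^ m" using \<open>l dvd p ^ n\<close> p by (metis divides_primepow_nat)
  with \<open>l < p\<close> have "l = 1"
    using p by (cases m) (auto simp: prime_gt_0_nat)
  then show ?thesis using l by simp
qed

section \<open>The automorphism group of a graph\<close>

text \<open>Automorphisms are determined only on the vertex set; requiring that the other points be
fixed makes composition of functions a group operation with identity \<open>id\<close>.\<close>
definition aut_group :: "'a ugraph \<Rightarrow> ('a \<Rightarrow> 'a) monoid" where
  "aut_group X = \<lparr>carrier = {g. g permutes verts X \<and> automorphism X g}, mult = (\<circ>), one = id\<rparr>"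

lemma aut_groupI:
  assumes "g permutes verts X"
    and "\<And>u v. u \<in> verts X \<Longrightarrow> v \<in> verts X \<Longrightarrow> {g u, g v} \<in> edges X \<longleftrightarrow> {u, v} \<in> edges X"
  shows "g \<in> carrier (aut_group X)"
  using assms permutes_imp_bij[OF assms(1)] by (simp add: aut_group_def automorphism_def)

lemma aut_group_permutes: "g \<in> carrier (aut_group X) \<Longrightarrow> g permutes verts X"
  by (simp add: aut_group_def)

lemma aut_group_edge_iff:
  assumes "g \<in> carrier (aut_group X)" "u \<in> verts X" "v \<in> verts X"
  shows "{g u, g v} \<in> edges X \<longleftrightarrow> {u, v} \<in> edges X"
  using assms by (simp only: aut_group_def automorphism_def partial_object.select_convs mem_Collect_eq)

lemma aut_group_verts_iff: "g \<in> carrier (aut_group X) \<Longrightarrow> g v \<in> verts X \<longleftrightarrow> v \<in> verts X"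
  using permutes_in_image[OF aut_group_permutes] .

lemma mult_aut_group [simp]: "g \<otimes>\<^bsub>aut_group X\<^esub> h = g \<circ> h"
  and one_aut_group [simp]: "\<one>\<^bsub>aut_group X\<^esub> = id"
  by (simp_all add: aut_group_def)

lemma pow_aut_group [simp]: "g [^]\<^bsub>aut_group X\<^esub> (n::nat) = g ^^ n"
  by (induction n) (simp_all add: nat_pow_def aut_group_def funpow_swap1 fun_eq_iff)

lemma group_aut_group: "group (aut_group X)"
proof (rule groupI)
  fix g h assume gh: "g \<in> carrier (aut_group X)" "h \<in> carrier (aut_group X)"
  show "g \<otimes>\<^bsub>aut_group X\<^esub> h \<in> carrier (aut_group X)"
    unfolding mult_aut_group
  proof (rule aut_groupI)
    show "(g \<circ> h) permutes verts X"
      using gh by (intro permutes_compose aut_group_permutes)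
    show "{(g \<circ> h) u, (g \<circ> h) v} \<in> edges X \<longleftrightarrow> {u, v} \<in> edges X"
      if "u \<in> verts X" "v \<in> verts X" for u v
      using gh that by (simp add: aut_group_edge_iff aut_group_verts_iff)
  qed
next
  show "\<one>\<^bsub>aut_group X\<^esub> \<in> carrier (aut_group X)"
    unfolding one_aut_group by (rule aut_groupI) (simp_all add: permutes_id)
next
  fix g assume g: "g \<in> carrier (aut_group X)"
  note gp = aut_group_permutes[OF g]
  have "Hilbert_Choice.inv g \<in> carrier (aut_group X)"
  proof (rule aut_groupI)
    show "Hilbert_Choice.inv g permutes verts X" using gp by (rule permutes_inv)
    show "{Hilbert_Choice.inv g u, Hilbert_Choice.inv g v} \<in> edges X \<longleftrightarrow> {u, v} \<in> edges X"
      if "u \<in> verts X" "v \<in> verts X" for u v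
      using that aut_group_edge_iff[OF g, of "Hilbert_Choice.inv g u" "Hilbert_Choice.inv g v"] permutes_inverses(1)[OF gp]
      by (simp add: permutes_in_image[OF permutes_inv[OF gp]])
  qed
  moreover have "Hilbert_Choice.inv g \<circ> g = id" using permutes_inv_o(2)[OF gp] .
  ultimately show "\<exists>h\<in>carrier (aut_group X). h \<otimes>\<^bsub>aut_group X\<^esub> g = \<one>\<^bsub>aut_group X\<^esub>"
    by auto
qed (simp_all add: comp_assoc)

lemma finite_aut_group: "finite (verts X) \<Longrightarrow> finite (carrier (aut_group X))"
  by (rule finite_subset[OF _ finite_permutations[of "verts X"]]) (auto simp: aut_group_def)

text \<open>A subgroup of order \<open>p\<^sup>2\<close> would have more elements than there are vertices. Two of its elements
would then agree at \<open>v\<close>, and their quotient would be a nontrivial element of \<open>p\<close>-power order in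
the stabiliser of \<open>v\<close>.\<close>
lemma prime_square_not_dvd_order_aut_group:
  assumes p: "prime p" and fin: "finite (verts X)" and v: "v \<in> verts X"
    and small: "card (verts X) < p\<^sup>2"
    and rigid: "\<And>h. h \<in> carrier (aut_group X) \<Longrightarrow> h ^^ (p\<^sup>2) = id \<Longrightarrow> h v = v \<Longrightarrow> h = id"
  shows "\<not> p\<^sup>2 dvd order (aut_group X)"
proof
  interpret G: group "aut_group X" by (rule group_aut_group)
  assume "p\<^sup>2 dvd order (aut_group X)"
  then obtain m where "order (aut_group X) = p\<^sup>2 * m" by blast
  then obtain H where H: "subgroup H (aut_group X)" "card H = p\<^sup>2"
    using sylow_thm[OF p group_aut_group] finite_aut_group[OF fin] by blast
  interpret H: subgroup H "aut_group X" by (rule H(1))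
  have gH: "group (aut_group X\<lparr>carrier := H\<rparr>)" by (rule H.subgroup_is_group) (rule group_aut_group)
  have perm: "h permutes verts X" if "h \<in> H" for h
    using H.subset that by (auto simp: aut_group_def)
  have "\<not> inj_on (\<lambda>h. h v) H"
  proof
    assume "inj_on (\<lambda>h. h v) H"
    moreover have "(\<lambda>h. h v) ` H \<subseteq> verts X" using perm v permutes_in_image by fastforce
    ultimately have "card H \<le> card (verts X)" using fin card_inj_on_le by blast
    then show False using H(2) small by simp
  qed
  then obtain g h where gh: "g \<in> H" "h \<in> H" "g \<noteq> h" "g v = h v"
    by (auto simp: inj_on_def)
  define f where "f = inv\<^bsub>aut_group X\<^esub> g \<circ> h"
  have fH: "f \<in> H" using gh unfolding f_def by (metis H.m_closed H.m_inv_closed mult_aut_group)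
  have inv: "inv\<^bsub>aut_group X\<^esub> g \<circ> g = id"
    using gh H.mem_carrier G.l_inv by (metis mult_aut_group one_aut_group)
  have "f ^^ (p\<^sup>2) = id"
  proof -
    interpret HG: group "aut_group X\<lparr>carrier := H\<rparr>" by (rule gH)
    have "f [^]\<^bsub>aut_group X\<lparr>carrier := H\<rparr>\<^esub> (p\<^sup>2) = \<one>\<^bsub>aut_group X\<lparr>carrier := H\<rparr>\<^esub>"
      using HG.pow_order_eq_1[of f] fH H(2) by (simp add: order_def)
    then show ?thesis by (simp flip: G.nat_pow_consistent)
  qed
  moreover have "f v = v" using inv gh(4) by (metis comp_apply f_def id_apply)
  ultimately have "f = id" using rigid fH H.mem_carrier by blast
  have "g \<circ> inv\<^bsub>aut_group X\<^esub> g = id"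
    using gh H.mem_carrier G.r_inv by (metis mult_aut_group one_aut_group)
  then have "h = g \<circ> f" unfolding f_def by (simp flip: comp_assoc)
  then show False using \<open>f = id\<close> gh(3) by simp
qed

section \<open>Adjacency in the graphs \<open>X(m,n;r)\<close>\<close>

lemma verts_X_graph [simp]: "verts (X_graph m n r) = {0..<m} \<times> {0..<n}"
  by (simp add: X_graph_def)

lemma edge_X_graph_iff:
  assumes "i < m" "j < n" "i' < m" "j' < n"
  shows "{(i, j), (i', j')} \<in> edges (X_graph m n r) \<longleftrightarrow>
    i = i' \<and> (j' = (j + r ^ i) mod n \<or> j = (j' + r ^ i) mod n) \<or>
    j = j' \<and> (i' = (i + 1) mod m \<or> i = (i' + 1) mod m)"
  using assms by (auto simp: X_graph_def doubleton_eq_iff)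

section \<open>Hamilton cycles and automorphisms preserving the layers\<close>

lemma length_hamilton_cycle: "hamilton_cycle X C \<Longrightarrow> length C = card (verts X)"
  unfolding hamilton_cycle_def using distinct_card by metis

lemma hamilton_cycle_map_automorphism:
  assumes g: "g \<in> carrier (aut_group X)" and C: "hamilton_cycle X C"
  shows "hamilton_cycle X (map g C)"
  unfolding hamilton_cycle_def
proof (intro conjI allI impI)
  note gp = aut_group_permutes[OF g]
  have C': "distinct C" "set C = verts X" "length C \<ge> 3"
    using C by (auto simp: hamilton_cycle_def)
  show "distinct (map g C)"
    using C'(1) permutes_inj_on[OF gp] by (simp add: distinct_map)
  show "set (map g C) = verts X"
    using C'(2) permutes_image[OF gp] by simp
  show "3 \<le> length (map g C)" using C' by simp
  fix i assume i: "i < length (map g C)"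
  define j where "j = (i + 1) mod length C"
  have j: "j < length C" using i unfolding j_def by (intro mod_less_divisor) auto
  have "{C ! i, C ! j} \<in> edges X" using C i by (simp add: hamilton_cycle_def j_def)
  moreover have "C ! i \<in> verts X" "C ! j \<in> verts X"
    using nth_mem[of i C] nth_mem[of j C] i j unfolding C'(2) by simp_all
  ultimately have "{g (C ! i), g (C ! j)} \<in> edges X" using aut_group_edge_iff[OF g] by simp
  then show "{map g C ! i, map g C ! ((i + 1) mod length (map g C))} \<in> edges X"
    using i j by (simp add: j_def)
qed

text \<open>The \<open>i\<close>-th layer consists of the vertices with first component \<open>i\<close>. As \<open>\<gamma>\<close> preserves the layers,
the layer of the \<open>i\<close>-th vertex of the cycle depends only on \<open>i\<close> modulo \<open>k\<close>. The cycle visits all \<open>k\<close> layers,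
hence any \<open>k\<close> successive vertices lie in different layers. All edges of the cycle therefore join
two different layers, and such edges do not change the second component.\<close>
lemma no_layer_preserving_shift:
  assumes k: "k \<ge> 2" and p: "p \<ge> 2" and D: "hamilton_cycle (X_graph k p r) D"
    and layer: "\<And>w. fst (\<gamma> w) = fst w"
    and shift: "\<And>i. i < length D \<Longrightarrow> \<gamma> (D ! i) = D ! ((i + k) mod length D)"
  shows False
proof -
  define N where "N = length D"
  have N: "N = k * p" using length_hamilton_cycle[OF D] by (simp add: N_def)
  have N0: "N > 0" using k p unfolding N by simp
  have set_D: "set D = {0..<k} \<times> {0..<p}" using D by (simp add: hamilton_cycle_def)
  define f where "f i = fst (D ! (i mod N))" for i
  define g where "g i = snd (D ! (i mod N))" for i
  have in_D: "D ! (i mod N) \<in> {0..<k} \<times> {0..<p}" for i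
    using N0 nth_mem[of "i mod N" D] set_D unfolding N_def by simp
  have fk: "f i < k" and gp: "g i < p" for i
    using in_D[of i] unfolding f_def g_def by (auto simp: mem_Times_iff)
  have f_period: "f (i + k) = f i" for i
  proof -
    have "\<gamma> (D ! (i mod N)) = D ! ((i + k) mod N)"
      using shift[of "i mod N"] N0 by (simp add: N_def mod_add_left_eq)
    then show ?thesis using layer[of "D ! (i mod N)"] unfolding f_def by simp
  qed
  have f_mod: "f i = f (i mod k)" for i
  proof -
    have "f (j + m * k) = f j" for j m
      by (induction m) (simp_all add: f_period add.assoc[symmetric] add.commute[of k])
    from this[of "i mod k" "i div k"] show ?thesis by simp
  qed
  have surj: "\<exists>n. f n = i \<and> g n = j" if "i < k" "j < p" for i j
  proof -
    have "(i, j) \<in> set D" using that set_D by simp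
    then obtain n where "n < N" "D ! n = (i, j)" unfolding in_set_conv_nth N_def by blast
    then show ?thesis unfolding f_def g_def by (intro exI[of _ n]) simp
  qed
  have "f ` {0..<k} = {0..<k}"
  proof
    show "f ` {0..<k} \<subseteq> {0..<k}" using fk by auto
    show "{0..<k} \<subseteq> f ` {0..<k}"
    proof
      fix i assume "i \<in> {0..<k}"
      then obtain n where "f n = i" using surj[of i 0] p by auto
      then have "f (n mod k) = i" using f_mod[of n] by simp
      then show "i \<in> f ` {0..<k}" using k by (intro image_eqI[of _ _ "n mod k"]) auto
    qed
  qed
  then have inj: "inj_on f {0..<k}" by (intro eq_card_imp_inj_on) auto
  have step: "f (i + 1) \<noteq> f i" for i
  proof
    assume "f (i + 1) = f i"
    then have "f ((i + 1) mod k) = f (i mod k)" using f_mod by metis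
    then have "(i + 1) mod k = i mod k" using inj k by (auto simp: inj_on_def)
    then have "[i + 1 = i + 0] (mod k)" by (simp add: cong_def)
    then have "[1 = 0] (mod k)" by (simp only: cong_add_lcancel_nat)
    then show False using k by (simp add: cong_def)
  qed
  have "g (i + 1) = g i" for i
  proof -
    have "{D ! (i mod N), D ! ((i + 1) mod N)} \<in> edges (X_graph k p r)"
      using D N0 unfolding hamilton_cycle_def N_def
      by (metis mod_add_left_eq mod_less_divisor)
    then have "{(f i, g i), (f (i + 1), g (i + 1))} \<in> edges (X_graph k p r)"
      unfolding f_def g_def by simp
    then show ?thesis
      using step[of i] unfolding edge_X_graph_iff[OF fk gp fk gp] by auto
  qed
  then have "g i = g 0" for i by (induction i) auto
  moreover obtain n n' where "g n = 0" "g n' = 1"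
    using surj[of 0 0] surj[of 0 1] k p by auto
  ultimately show False by (metis zero_neq_one)
qed

section \<open>The rotation of all layers\<close>

lemma inj_mod_add:
  fixes a b c n :: nat
  assumes "a < n" "b < n"
  shows "(a + c) mod n = (b + c) mod n \<longleftrightarrow> a = b"
proof -
  have "(a + c) mod n = (b + c) mod n \<longleftrightarrow> [a + c = b + c] (mod n)" by (simp add: cong_def)
  also have "\<dots> \<longleftrightarrow> [a = b] (mod n)" by (rule cong_add_rcancel_nat)
  finally show ?thesis using assms by (simp add: cong_def)
qed

lemma inj_mod_mult:
  fixes a b c n :: nat
  assumes "a < n" "b < n" "coprime c n"
  shows "(c * a) mod n = (c * b) mod n \<longleftrightarrow> a = b"
proof -
  have "(c * a) mod n = (c * b) mod n \<longleftrightarrow> [c * a = c * b] (mod n)" by (simp add: cong_def)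
  also have "\<dots> \<longleftrightarrow> [a = b] (mod n)" using assms(3) by (rule cong_mult_lcancel_nat)
  finally show ?thesis using assms by (simp add: cong_def)
qed

definition layer_rotation :: "nat \<Rightarrow> nat \<Rightarrow> nat \<times> nat \<Rightarrow> nat \<times> nat" where
  "layer_rotation m n w = (if w \<in> {0..<m} \<times> {0..<n} then (fst w, (snd w + 1) mod n) else w)"

lemma layer_rotation_in_aut_group:
  "layer_rotation m n \<in> carrier (aut_group (X_graph m n r))"
proof (rule aut_groupI)
  have inj: "inj_on (layer_rotation m n) ({0..<m} \<times> {0..<n})"
  proof (rule inj_onI)
    fix u v assume "u \<in> {0..<m} \<times> {0..<n}" "v \<in> {0..<m} \<times> {0..<n}"
      "layer_rotation m n u = layer_rotation m n v"
    then show "u = v"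
      using inj_mod_add[of "snd u" n "snd v" 1] by (auto simp: layer_rotation_def)
  qed
  moreover have "layer_rotation m n ` ({0..<m} \<times> {0..<n}) \<subseteq> {0..<m} \<times> {0..<n}"
    by (auto simp: layer_rotation_def)
  ultimately have "bij_betw (layer_rotation m n) ({0..<m} \<times> {0..<n}) ({0..<m} \<times> {0..<n})"
    by (simp add: bij_betw_def endo_inj_surj)
  then have "layer_rotation m n permutes ({0..<m} \<times> {0..<n})"
    by (rule bij_imp_permutes) (simp add: layer_rotation_def)
  then show "layer_rotation m n permutes verts (X_graph m n r)" by simp
  fix u v assume "u \<in> verts (X_graph m n r)" "v \<in> verts (X_graph m n r)"
  then obtain i j i' j' where uv: "u = (i, j)" "v = (i', j')" "i < m" "j < n" "i' < m" "j' < n"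
    by auto
  have s: "(j' + 1) mod n = ((j + 1) mod n + s) mod n \<longleftrightarrow> j' = (j + s) mod n"
    if "j < n" "j' < n" for j j' s
  proof -
    have "((j + 1) mod n + s) mod n = ((j + s) mod n + 1) mod n"
      by (simp add: mod_simps add_ac)
    then show ?thesis using inj_mod_add[of j' n "(j + s) mod n" 1] that by auto
  qed
  have "{layer_rotation m n u, layer_rotation m n v}
      = {(i, (j + 1) mod n), (i', (j' + 1) mod n)}"
    using uv by (simp add: layer_rotation_def)
  moreover have "(j + 1) mod n = (j' + 1) mod n \<longleftrightarrow> j = j'"
    by (rule inj_mod_add[OF uv(4,6)])
  ultimately show "{layer_rotation m n u, layer_rotation m n v} \<in> edges (X_graph m n r) \<longleftrightarrow>
      {u, v} \<in> edges (X_graph m n r)"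
    using uv s[of j j' "r ^ i"] s[of j' j "r ^ i"] by (simp add: edge_X_graph_iff)
qed

lemma layer_rotation_funpow:
  assumes "i < m" "j < n"
  shows "(layer_rotation m n ^^ t) (i, j) = (i, (j + t) mod n)"
proof (induction t)
  case (Suc t)
  then show ?case using assms by (simp add: layer_rotation_def mod_Suc_eq)
qed (use assms in simp)

lemma fst_layer_rotation_funpow: "fst ((layer_rotation m n ^^ t) w) = fst w"
  by (induction t) (simp_all add: layer_rotation_def)

lemma layer_rotation_funpow_order: "layer_rotation m n ^^ n = id"
proof
  fix w :: "nat \<times> nat"
  have off: "(layer_rotation m n ^^ t) w = w" if "w \<notin> {0..<m} \<times> {0..<n}" for t
    using that by (induction t) (simp_all add: layer_rotation_def)
  show "(layer_rotation m n ^^ n) w = id w"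
  proof (cases "w \<in> {0..<m} \<times> {0..<n}")
    case True
    then show ?thesis using layer_rotation_funpow[of "fst w" m "snd w" n n] by (auto simp: mem_Times_iff)
  next
    case False
    then show ?thesis using off by simp
  qed
qed

lemma layer_rotation_neq_id:
  assumes "m > 0" "n \<ge> 2"
  shows "layer_rotation m n \<noteq> id"
proof
  assume "layer_rotation m n = id"
  then have "layer_rotation m n (0, 0) = (0, 0)" by simp
  then show False using assms by (simp add: layer_rotation_def)
qed

section \<open>The vertex stabiliser has no element of order \<open>p\<close>\<close>

lemma neighbours_X_graph:
  assumes "i < m" "j < n"
  shows "{w \<in> verts (X_graph m n r). {(i, j), w} \<in> edges (X_graph m n r)} \<subseteq>
    {(i, (j + r ^ i) mod n), (i, (j + (n - r ^ i mod n)) mod n),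
     ((i + 1) mod m, j), ((i + (m - 1)) mod m, j)}"
proof
  fix w assume "w \<in> {w \<in> verts (X_graph m n r). {(i, j), w} \<in> edges (X_graph m n r)}"
  then obtain i' j' where w: "w = (i', j')" "i' < m" "j' < n"
    "{(i, j), (i', j')} \<in> edges (X_graph m n r)" by auto
  have pred: "a = (b + (d - c mod d)) mod d" if "a < d" "b = (a + c) mod d" for a b c d :: nat
  proof -
    have "(b + (d - c mod d)) mod d = ((a + c) + (d - c mod d)) mod d"
      using that(2) by (simp add: mod_add_left_eq)
    also have "(a + c) + (d - c mod d) = a + (c div d + 1) * d"
    proof -
      have "c mod d \<le> d" using that(1) by (simp add: less_imp_le)
      moreover have "c = c div d * d + c mod d" by simp
      ultimately have "c + (d - c mod d) = c div d * d + d" by linarith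
      then show ?thesis by simp
    qed
    finally have "(b + (d - c mod d)) mod d = (a + (c div d + 1) * d) mod d" .
    then show ?thesis using that(1) by (simp only: mod_mult_self1 mod_less)
  qed
  have "i' = (i + (m - 1)) mod m" if "i = (i' + 1) mod m"
    using pred[OF w(2) that] w(2) by (cases "m = 1") auto
  then show "w \<in> {(i, (j + r ^ i) mod n), (i, (j + (n - r ^ i mod n)) mod n),
     ((i + 1) mod m, j), ((i + (m - 1)) mod m, j)}"
    using w pred[OF w(3)] unfolding w(1) edge_X_graph_iff[OF assms w(2,3)] by auto
qed

lemma card_neighbours_X_graph:
  assumes "w \<in> verts (X_graph m n r)"
  shows "card {w' \<in> verts (X_graph m n r). {w, w'} \<in> edges (X_graph m n r)} \<le> 4"
proof -
  obtain i j where w: "w = (i, j)" "i < m" "j < n" using assms by auto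
  show ?thesis unfolding w(1)
    by (rule order.trans[OF card_mono[OF _ neighbours_X_graph[OF w(2,3)]]])
       (auto simp: card_insert_if)
qed

lemma aut_fixes_neighbours:
  assumes p: "prime p" and fin: "finite (verts X)" and h: "h \<in> carrier (aut_group X)"
    and pow: "h ^^ (p ^ e) = id" and u: "u \<in> verts X" "h u = u"
    and deg: "card {w \<in> verts X. {u, w} \<in> edges X} < p"
    and w: "w \<in> verts X" "{u, w} \<in> edges X"
  shows "h w = w"
proof (rule fixes_each_point_of_small_invariant_set[OF p pow])
  show "h ` {w \<in> verts X. {u, w} \<in> edges X} \<subseteq> {w \<in> verts X. {u, w} \<in> edges X}"
    using aut_group_edge_iff[OF h u(1)] aut_group_verts_iff[OF h] u(2) by auto
qed (use fin deg w in auto)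

text \<open>An automorphism of a graph is one of its complement as well. For the triangular prism, which has
valency \<open>3\<close>, the complement (a hexagon) is the one whose valency is less than \<open>3\<close>.\<close>
lemma aut_fixes_non_neighbours:
  assumes p: "prime p" and fin: "finite (verts X)" and h: "h \<in> carrier (aut_group X)"
    and pow: "h ^^ (p ^ e) = id" and u: "u \<in> verts X" "h u = u"
    and deg: "card {w \<in> verts X. w \<noteq> u \<and> {u, w} \<notin> edges X} < p"
    and w: "w \<in> verts X" "w \<noteq> u" "{u, w} \<notin> edges X"
  shows "h w = w"
proof (rule fixes_each_point_of_small_invariant_set[OF p pow])
  have "h w \<noteq> u" if "w \<noteq> u" for w
    using permutes_inj[OF aut_group_permutes[OF h]] u(2) that by (metis injD)
  then show "h ` {w \<in> verts X. w \<noteq> u \<and> {u, w} \<notin> edges X}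
      \<subseteq> {w \<in> verts X. w \<noteq> u \<and> {u, w} \<notin> edges X}"
    using aut_group_edge_iff[OF h u(1)] aut_group_verts_iff[OF h] u(2) by auto
qed (use fin deg w in auto)

lemma aut_group_eq_idI:
  assumes "h \<in> carrier (aut_group X)" "\<And>w. w \<in> verts X \<Longrightarrow> h w = w"
  shows "h = id"
  using assms permutes_not_in[OF aut_group_permutes[OF assms(1)]] by fastforce

text \<open>The valency is at most \<open>4 < p\<close>, so the property of being a fixed point spreads from a vertex
to its neighbours, and the graph is connected: from the origin the fixed points spread along the layer
\<open>0\<close>, whose vertices with successive second components are adjacent because \<open>r ^ 0 = 1\<close>, and from there through the
columns.\<close>
lemma p_automorphism_fixing_origin_eq_id:
  assumes p: "prime p" "p > 4" and m: "m > 0"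
    and h: "h \<in> carrier (aut_group (X_graph m p r))" "h ^^ (p ^ e) = id" "h (0, 0) = (0, 0)"
  shows "h = id"
proof (rule aut_group_eq_idI[OF h(1)])
  have p0: "p > 0" using p by simp
  have nb: "h (i', j') = (i', j')"
    if "i < m" "j < p" "i' < m" "j' < p" "h (i, j) = (i, j)"
      "{(i, j), (i', j')} \<in> edges (X_graph m p r)" for i j i' j'
  proof (rule aut_fixes_neighbours[OF p(1) _ h(1,2) _ that(5)])
    show "card {w \<in> verts (X_graph m p r). {(i, j), w} \<in> edges (X_graph m p r)} < p"
      using card_neighbours_X_graph[of "(i, j)" m p r] that p by simp
  qed (use that in auto)
  have layer: "h (0, j) = (0, j)" if "j < p" for j
    using that
  proof (induction j)
    case (Suc j)
    then show ?case using nb[of 0 j 0 "Suc j"] m by (simp add: edge_X_graph_iff)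
  qed (use h(3) in simp)
  have column: "h (i, j) = (i, j)" if "i < m" "j < p" for i j
    using that(1)
  proof (induction i)
    case (Suc i)
    then show ?case using nb[of i j "Suc i" j] that(2) by (simp add: edge_X_graph_iff)
  qed (use that layer in simp)
  fix w assume "w \<in> verts (X_graph m p r)"
  then show "h w = w" using column by auto
qed

text \<open>Here the fixed points spread along the edges of the complement, the hexagon in which \<open>(i, j)\<close> is adjacent
to \<open>(1 - i, j')\<close> for \<open>j' \<noteq> j\<close>.\<close>
lemma three_automorphism_fixing_origin_of_prism_eq_id:
  assumes r: "coprime r 3"
    and h: "h \<in> carrier (aut_group (X_graph 2 3 r))" "h ^^ (3 ^ e) = id" "h (0, 0) = (0, 0)"
  shows "h = id"
proof (rule aut_group_eq_idI[OF h(1)])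
  let ?X = "X_graph 2 3 r"
  have "\<not> 3 dvd r ^ i" for i
  proof
    assume "3 dvd r ^ i"
    then have "3 dvd r" by (rule prime_dvd_power[rotated]) simp
    then show False using r by (metis coprime_common_divisor_nat dvd_refl numeral_eq_one_iff semiring_norm(86))
  qed
  then have r_cases: "r ^ i mod 3 = 1 \<or> r ^ i mod 3 = 2" for i
    by (simp add: dvd_eq_mod_eq_0) (metis mod_less_divisor zero_less_numeral less_Suc_eq numeral_3_eq_3 numeral_2_eq_2 One_nat_def not_less0 less_one)
  have layer: "{(i, j), (i, j')} \<in> edges ?X" if "i < 2" "j < 3" "j' < 3" "j \<noteq> j'" for i j j'
  proof -
    have "(j + r ^ i) mod 3 = (j + r ^ i mod 3) mod 3" for j by (simp add: mod_simps)
    moreover have "j \<in> {0, 1, 2}" "j' \<in> {0, 1, 2}" using that by auto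
    ultimately show ?thesis
      using r_cases[of i] that by (auto simp: edge_X_graph_iff)
  qed
  have step: "h (i', j') = (i', j')"
    if "i < 2" "j < 3" "i' < 2" "j' < 3" "i \<noteq> i'" "j \<noteq> j'" "h (i, j) = (i, j)" for i j i' j'
  proof (rule aut_fixes_non_neighbours[OF _ _ h(1,2) _ that(7)])
    have "{w \<in> verts ?X. w \<noteq> (i, j) \<and> {(i, j), w} \<notin> edges ?X} \<subseteq> {i'} \<times> ({0..<3} - {j})"
    proof
      fix w assume "w \<in> {w \<in> verts ?X. w \<noteq> (i, j) \<and> {(i, j), w} \<notin> edges ?X}"
      then obtain a b where w: "w = (a, b)" "a < 2" "b < 3" "(a, b) \<noteq> (i, j)"
        "{(i, j), (a, b)} \<notin> edges ?X" by (cases w) auto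
      have "a \<noteq> i" using layer[of i j b] w that by auto
      then have "a = i'" using w that by auto
      moreover have "b \<noteq> j"
      proof
        assume "b = j"
        moreover have "a = (i + 1) mod 2"
          using \<open>a \<noteq> i\<close> w(2) that(1) by (auto simp: less_2_cases_iff)
        ultimately show False
          using w(5) unfolding edge_X_graph_iff[OF that(1,2) w(2,3)] by simp
      qed
      ultimately show "w \<in> {i'} \<times> ({0..<3} - {j})" using w by auto
    qed
    then have "card {w \<in> verts ?X. w \<noteq> (i, j) \<and> {(i, j), w} \<notin> edges ?X}
        \<le> card ({i'} \<times> ({0..<3} - {j}))"
      by (intro card_mono) auto
    also have "\<dots> = 2" using that by (simp add: card_cartesian_product)
    finally show "card {w \<in> verts ?X. w \<noteq> (i, j) \<and> {(i, j), w} \<notin> edges ?X} < 3" by simp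
    show "{(i, j), (i', j')} \<notin> edges ?X" using that by (simp add: edge_X_graph_iff)
  qed (use that in auto)
  have f1: "h (1, 1) = (1, 1)" and f2: "h (1, 2) = (1, 2)"
    using step[OF _ _ _ _ _ _ h(3)] by auto
  have f3: "h (0, 1) = (0, 1)" using step[OF _ _ _ _ _ _ f2] by auto
  have f4: "h (0, 2) = (0, 2)" using step[OF _ _ _ _ _ _ f1] by auto
  have f5: "h (1, 0) = (1, 0)" using step[OF _ _ _ _ _ _ f3] by auto
  fix w assume "w \<in> verts ?X"
  then have "w \<in> {0, 1} \<times> {0, 1, 2}" by auto
  then show "h w = w" using f1 f2 f3 f4 f5 h(3) by auto
qed

section \<open>The upper bound\<close>

lemma automorphism_restrict_in_aut_group:
  assumes "automorphism X \<alpha>"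
  shows "(\<lambda>v. if v \<in> verts X then \<alpha> v else v) \<in> carrier (aut_group X)" (is "?a \<in> _")
proof (rule aut_groupI)
  have "bij_betw \<alpha> (verts X) (verts X)" using assms by (simp only: automorphism_def)
  then have "bij_betw ?a (verts X) (verts X)" by (simp cong: bij_betw_cong)
  then show "?a permutes verts X" by (rule bij_imp_permutes) simp
  show "{?a u, ?a v} \<in> edges X \<longleftrightarrow> {u, v} \<in> edges X" if "u \<in> verts X" "v \<in> verts X" for u v
  proof -
    have "{u, v} \<in> edges X \<longleftrightarrow> {\<alpha> u, \<alpha> v} \<in> edges X"
      using assms that by (simp only: automorphism_def)
    then show ?thesis using that by simp
  qed
qed

text \<open>If \<open>p\<close> divided \<open>l\<close>, a power \<open>b\<close> of the automorphism that rotates the cycle would have order \<open>p\<close> and move each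
vertex of the cycle by \<open>k\<close> steps. As \<open>p\<^sup>2\<close> does not divide the order of the automorphism group, \<open>b\<close> is
conjugate to a power of the layer rotation \<open>\<rho>\<close>, say \<open>b = g \<rho>\<^sup>t g\<^sup>-\<^sup>1\<close>. Then \<open>\<rho>\<^sup>t\<close> preserves the layers and
moves the Hamilton cycle \<open>g\<^sup>-\<^sup>1 C\<close> by \<open>k\<close> steps, which is impossible.\<close>
lemma prime_not_dvd_symmetry:
  assumes k: "k \<ge> 2" and p: "prime p" and kp: "k < p" and r: "coprime r p"
    and C: "hamilton_cycle (X_graph k p r) C" and sym: "symmetric_cycle (X_graph k p r) C l"
  shows "\<not> p dvd l"
proof
  let ?X = "X_graph k p r"
  interpret G: group "aut_group ?X" by (rule group_aut_group)
  assume "p dvd l"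
  then obtain q where q: "l = p * q" by blast
  define N where "N = length C"
  have N: "N = k * p" using length_hamilton_cycle[OF C] by (simp add: N_def)
  have p0: "p > 0" and p2: "p \<ge> 2" using k kp by auto
  have N0: "N > 0" using k p0 unfolding N by simp
  have set_C: "set C = verts ?X" using C by (simp add: hamilton_cycle_def)
  obtain \<alpha> where \<alpha>: "automorphism ?X \<alpha>" "\<And>i. i < N \<Longrightarrow> \<alpha> (C ! i) = C ! ((i + N div l) mod N)"
    and l: "l > 0" "l dvd N"
    using sym unfolding symmetric_cycle_def N_def by auto
  define d where "d = N div l"
  have "d * l = N" using l(2) by (simp add: d_def)
  then have dl: "d * (p * q) = k * p" by (simp add: q N)
  have qd: "q * d = k" using dl p0 by (simp add: mult.commute mult.left_commute)
  define a where "a v = (if v \<in> verts ?X then \<alpha> v else v)" for v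
  have aG: "a \<in> carrier (aut_group ?X)"
    using automorphism_restrict_in_aut_group[OF \<alpha>(1)] unfolding a_def .
  have C_in: "C ! (i mod N) \<in> verts ?X" for i
    using N0 nth_mem[of "i mod N" C] set_C unfolding N_def by simp
  have a_pow: "(a ^^ n) (C ! (i mod N)) = C ! ((i + n * d) mod N)" for n i
  proof (induction n)
    case (Suc n)
    have "a (C ! ((i + n * d) mod N)) = \<alpha> (C ! ((i + n * d) mod N))"
      using C_in[of "i + n * d"] by (simp only: a_def if_True)
    then have "(a ^^ Suc n) (C ! (i mod N)) = \<alpha> (C ! ((i + n * d) mod N))"
      using Suc by simp
    also have "\<dots> = C ! ((i + Suc n * d) mod N)"
    proof -
      have "\<alpha> (C ! ((i + n * d) mod N)) = C ! (((i + n * d) mod N + d) mod N)"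
        unfolding d_def by (rule \<alpha>(2)) (simp add: N0)
      also have "((i + n * d) mod N + d) mod N = (i + Suc n * d) mod N"
        by (simp only: mod_add_left_eq) (simp add: add_ac)
      finally show ?thesis .
    qed
    finally show ?case .
  qed simp
  define b where "b = a ^^ q"
  have bG: "b \<in> carrier (aut_group ?X)"
    using G.nat_pow_closed[OF aG, of q] by (simp add: b_def)
  have b_shift: "b (C ! (i mod N)) = C ! ((i + k) mod N)" for i
    using a_pow[of q i] qd by (simp add: b_def)
  have bp: "b ^^ p = id"
  proof (rule aut_group_eq_idI)
    show "b ^^ p \<in> carrier (aut_group ?X)"
      using G.nat_pow_closed[OF bG, of p] by simp
    fix w assume "w \<in> verts ?X"
    then obtain i where i: "i < N" "w = C ! i" using set_C unfolding N_def by (metis in_set_conv_nth)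
    have "b ^^ p = a ^^ (p * q)" by (simp add: b_def funpow_mult mult.commute)
    then have "(b ^^ p) w = C ! ((i + p * q * d) mod N)" using a_pow[of "p * q" i] i by simp
    also have "p * q * d = N" using qd N by (simp add: mult_ac)
    finally show "(b ^^ p) w = w" using i by simp
  qed
  \<comment> \<open>A \<open>p\<close>-element fixing the origin is trivial; only \<open>p = 3\<close>, \<open>k = 2\<close> gives a valency that is not below \<open>p\<close>.\<close>
  have np2: "\<not> p\<^sup>2 dvd order (aut_group ?X)"
  proof (rule prime_square_not_dvd_order_aut_group[OF p])
    show "(0, 0) \<in> verts ?X" using k p0 by simp
    show "card (verts ?X) < p\<^sup>2" using kp p0 by (simp add: power2_eq_square)
    fix h assume h: "h \<in> carrier (aut_group ?X)" "h ^^ (p\<^sup>2) = id" "h (0, 0) = (0, 0)"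
    show "h = id"
    proof (cases "p > 4")
      case True
      then show ?thesis using p_automorphism_fixing_origin_eq_id[OF p True _ h] k by simp
    next
      case False
      then have "p \<in> {0, 1, 2, 3, 4}" by auto
      moreover have "\<not> prime (4::nat)" using prime_product[of 2 2] by auto
      ultimately have "p = 3" using p k kp by auto
      moreover then have "k = 2" using k kp by simp
      ultimately show ?thesis using three_automorphism_fixing_origin_of_prism_eq_id[of r h 2] r h by simp
    qed
  qed simp
  let ?\<rho> = "layer_rotation k p"
  obtain g t where g: "g \<in> carrier (aut_group ?X)" and conj: "b \<circ> g = g \<circ> ?\<rho> ^^ t"
    using G.conjugate_to_power_of_prime_order[OF p finite_aut_group np2
        layer_rotation_in_aut_group _ _ bG] bp layer_rotation_funpow_order
      layer_rotation_neq_id[of k p] k p2 by auto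
  define g' where "g' = inv\<^bsub>aut_group ?X\<^esub> g"
  have g': "g' \<in> carrier (aut_group ?X)" using g by (simp add: g'_def)
  have "g \<circ> g' = id" "g' \<circ> g = id" using G.r_inv[OF g] G.l_inv[OF g] by (simp_all add: g'_def)
  then have gg': "g (g' w) = w" "g' (g w) = w" for w by (metis comp_apply id_apply)+
  show False
  proof (rule no_layer_preserving_shift[OF k p2])
    show "hamilton_cycle ?X (map g' C)" by (rule hamilton_cycle_map_automorphism[OF g' C])
    show "fst ((?\<rho> ^^ t) w) = fst w" for w by (rule fst_layer_rotation_funpow)
    fix i assume i: "i < length (map g' C)"
    have "b w = g ((?\<rho> ^^ t) (g' w))" for w
      using fun_cong[OF conj, of "g' w"] gg'(1)[of w] by simp
    then have "(?\<rho> ^^ t) (g' w) = g' (b w)" for w using gg'(2) by simp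
    then show "(?\<rho> ^^ t) (map g' C ! i) = map g' C ! ((i + k) mod length (map g' C))"
      using i b_shift[of i] N0 by (simp add: N_def)
  qed
qed

lemma symmetry_order_le:
  assumes k: "k \<ge> 2" and p: "prime p" and kp: "k < p" and r: "coprime r p"
    and C: "hamilton_cycle (X_graph k p r) C" and sym: "symmetric_cycle (X_graph k p r) C l"
  shows "l \<le> k"
proof -
  have "coprime p l"
    using prime_not_dvd_symmetry[OF assms] p by (simp add: prime_imp_coprime)
  moreover have "l dvd k * p"
    using sym length_hamilton_cycle[OF C] by (simp add: symmetric_cycle_def)
  ultimately have "l dvd k" by (simp add: coprime_commute coprime_dvd_mult_left_iff)
  then show ?thesis using k by (intro dvd_imp_le) auto
qed

section \<open>A Hamilton cycle with rotational symmetry of order \<open>k\<close>\<close>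

definition layer_shift :: "nat \<Rightarrow> nat \<Rightarrow> nat \<Rightarrow> nat \<times> nat \<Rightarrow> nat \<times> nat" where
  "layer_shift m n r w = ((fst w + 1) mod m, (r * snd w) mod n)"

lemma automorphism_layer_shift:
  assumes m: "m > 0" and n: "n > 0" and r: "coprime r n" "[r ^ m = 1] (mod n)"
  shows "automorphism (X_graph m n r) (layer_shift m n r)"
  unfolding automorphism_def
proof (intro conjI ballI)
  let ?V = "{0..<m} \<times> {0..<n}"
  have "inj_on (layer_shift m n r) ?V"
  proof (rule inj_onI)
    fix u v assume "u \<in> ?V" "v \<in> ?V" "layer_shift m n r u = layer_shift m n r v"
    then show "u = v"
      using inj_mod_add[of "fst u" m "fst v" 1] inj_mod_mult[of "snd u" n "snd v" r] r
      by (auto simp: layer_shift_def)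
  qed
  moreover have "layer_shift m n r ` ?V \<subseteq> ?V"
    using m n by (auto simp: layer_shift_def)
  ultimately show "bij_betw (layer_shift m n r) (verts (X_graph m n r)) (verts (X_graph m n r))"
    by (simp add: bij_betw_def endo_inj_surj)
  fix u v assume "u \<in> verts (X_graph m n r)" "v \<in> verts (X_graph m n r)"
  then obtain i j i' j' where uv: "u = (i, j)" "v = (i', j')" "i < m" "j < n" "i' < m" "j' < n"
    by auto
  have pow: "r ^ ((i + 1) mod m) mod n = r * r ^ i mod n" if "i < m" for i
  proof (cases "i + 1 = m")
    case True
    then show ?thesis using r(2) by (simp add: cong_def flip: True)
  next
    case False
    then show ?thesis using that by simp
  qed
  have s: "(r * j') mod n = ((r * j) mod n + r ^ ((i + 1) mod m)) mod n \<longleftrightarrow> j' = (j + r ^ i) mod n"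
    if "j < n" "j' < n" "i < m" for i j j'
  proof -
    have "((r * j) mod n + r ^ ((i + 1) mod m)) mod n = (r * j + r ^ ((i + 1) mod m) mod n) mod n"
      by (simp add: mod_simps)
    also have "\<dots> = (r * ((j + r ^ i) mod n)) mod n"
      unfolding pow[OF that(3)] by (simp add: mod_simps algebra_simps)
    finally show ?thesis using inj_mod_mult[of j' n "(j + r ^ i) mod n" r] that r(1) n by auto
  qed
  have "{layer_shift m n r u, layer_shift m n r v}
      = {((i + 1) mod m, (r * j) mod n), ((i' + 1) mod m, (r * j') mod n)}"
    using uv by (simp add: layer_shift_def)
  moreover have "(r * j) mod n = (r * j') mod n \<longleftrightarrow> j = j'"
    by (rule inj_mod_mult[OF uv(4,6) r(1)])
  moreover have "(i + 1) mod m = (i' + 1) mod m \<longleftrightarrow> i = i'"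
    by (rule inj_mod_add[OF uv(3,5)])
  moreover have "(i' + 1) mod m = ((i + 1) mod m + 1) mod m \<longleftrightarrow> i' = (i + 1) mod m"
    using inj_mod_add[of i' m "(i + 1) mod m" 1] uv by simp
  moreover have "(i + 1) mod m = ((i' + 1) mod m + 1) mod m \<longleftrightarrow> i = (i' + 1) mod m"
    using inj_mod_add[of i m "(i' + 1) mod m" 1] uv by simp
  ultimately show "{u, v} \<in> edges (X_graph m n r) \<longleftrightarrow>
      {layer_shift m n r u, layer_shift m n r v} \<in> edges (X_graph m n r)"
    using uv s[of j j' i] s[of j' j i] m n by (simp only: edge_X_graph_iff mod_less_divisor)
qed

text \<open>The cycle goes around layer \<open>i\<close> in steps of \<open>r ^ i\<close>, starting at the vertex \<open>(i, r ^ i * c)\<close>. After \<open>p - 1\<close> steps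
it has visited the whole layer and is at \<open>(i, r ^ i * (c - 1))\<close>, where it passes to the next layer. The layer
shift \<open>(i, j) \<mapsto> (i + 1, r * j)\<close> moves this walk by \<open>p\<close> steps provided that the next layer is
entered at \<open>(i + 1, r ^ (i + 1) * c)\<close>, that is, if \<open>c - 1 = r * c\<close> modulo \<open>p\<close>. This equation can be solved as
\<open>r\<close> is not congruent to \<open>1\<close>. The walk closes up because \<open>r ^ k\<close> is congruent to \<open>1\<close>.\<close>
lemma exists_symmetric_hamilton_cycle:
  assumes k: "k \<ge> 2" and p: "prime p" and kp: "k < p" and r: "coprime r p"
    and ord: "ord p r = k"
  obtains C where "hamilton_cycle (X_graph k p r) C" "symmetric_cycle (X_graph k p r) C k"
proof -
  have p0: "p > 0" using kp by simp
  have rk: "[r ^ k = 1] (mod p)" using ord ord_works by metis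
  have r0: "r > 0" using r k kp by (intro Nat.gr0I) auto
  have "\<not> [r = 1] (mod p)"
    using ord_divides[of r 1 p] ord k by simp
  then have "\<not> p dvd r - 1" using r0 cong_altdef_nat[of 1 r p] by (simp add: cong_sym_eq)
  then have "coprime p (r - 1)" by (rule prime_imp_coprime[OF p])
  then have "coprime (r - 1) p" by (subst coprime_commute)
  then obtain x where x: "[(r - 1) * x = 1] (mod p)" using cong_solve_coprime_nat by auto
  \<comment> \<open>Since \<open>p - 1\<close> represents \<open>-1\<close>, this \<open>c\<close> solves \<open>(r - 1) * c = -1\<close>.\<close>
  define c where "c = x * (p - 1)"
  have "[(r - 1) * x * (p - 1) = 1 * (p - 1)] (mod p)" using x by (rule cong_scalar_right)
  then have "[(r - 1) * c = p - 1] (mod p)" by (simp only: c_def mult.assoc mult_1)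
  then have "[(r - 1) * c + (c + 1) = p - 1 + (c + 1)] (mod p)"
    by (rule cong_add[OF _ cong_refl])
  moreover have "(r - 1) * c + (c + 1) = r * c + 1" using r0 by (cases r) auto
  moreover have "p - 1 + (c + 1) = c + p" using p0 by simp
  ultimately have c: "[r * c + 1 = c] (mod p)" by (simp only: cong_def mod_add_self2)
  have turn: "[r * c = c + (p - 1)] (mod p)"
  proof -
    have "[r * c + 1 + (p - 1) = c + (p - 1)] (mod p)" by (rule cong_add[OF c cong_refl])
    moreover have "r * c + 1 + (p - 1) = r * c + p" using p0 by simp
    ultimately show ?thesis by (simp only: cong_def mod_add_self2)
  qed
  let ?X = "X_graph k p r"
  \<comment> \<open>The walk is defined for all \<open>n\<close>, so that closing up becomes periodicity.\<close>
  define F where "F n = (n div p mod k, r ^ (n div p) * (c + n mod p) mod p)" for n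
  define N where "N = k * p"
  define C where "C = map F [0..<N]"
  have rpow: "[r ^ (k * m) = 1] (mod p)" for m
    using cong_pow[OF rk, of m] by (simp add: power_mult)
  have F_period: "F (n + N) = F n" for n
  proof -
    have "[r ^ k * r ^ (n div p) = 1 * r ^ (n div p)] (mod p)" using rk by (rule cong_scalar_right)
    then have "[r ^ k * r ^ (n div p) * (c + n mod p) = 1 * r ^ (n div p) * (c + n mod p)] (mod p)"
      by (rule cong_scalar_right)
    then show ?thesis using p0 by (simp add: F_def N_def power_add cong_def)
  qed
  have F_mod: "F (n mod N) = F n" for n
  proof -
    have "F (j + m * N) = F j" for j m
    proof (induction m)
      case (Suc m)
      have "F (j + Suc m * N) = F (j + m * N + N)" by (simp add: add_ac)
      then show ?case using Suc by (simp only: F_period)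
    qed simp
    from this[of "n mod N" "n div N"] show ?thesis by simp
  qed
  have N0: "N > 0" using k p0 by (simp add: N_def)
  have F_in: "F n \<in> verts ?X" for n using k p0 by (simp add: F_def)
  have "inj_on F {0..<N}"
  proof (rule inj_onI)
    fix n n' assume n: "n \<in> {0..<N}" "n' \<in> {0..<N}" "F n = F n'"
    have "n div p < k" "n' div p < k" using n p0 by (simp_all add: N_def less_mult_imp_div_less)
    then have d: "n div p = n' div p" using n(3) by (simp add: F_def)
    then have "[r ^ (n div p) * (c + n mod p) = r ^ (n div p) * (c + n' mod p)] (mod p)"
      using n(3) by (simp add: F_def cong_def)
    moreover have "coprime (r ^ (n div p)) p" using r by simp
    ultimately have "[c + n mod p = c + n' mod p] (mod p)" using cong_mult_lcancel_nat by blast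
    then have "[n mod p = n' mod p] (mod p)" by (simp only: cong_add_lcancel_nat)
    then have "n mod p = n' mod p" by (simp add: cong_def)
    with d show "n = n'" by (metis div_mult_mod_eq)
  qed
  moreover have "F ` {0..<N} \<subseteq> verts ?X" using F_in by blast
  ultimately have F_onto: "F ` {0..<N} = verts ?X"
    by (intro card_subset_eq) (simp_all add: card_image N_def)
  have F_edge: "{F n, F (n + 1)} \<in> edges ?X" for n
  proof (cases "n mod p = p - 1")
    case True
    then have d: "(n + 1) div p = n div p + 1" "(n + 1) mod p = 0"
      using p0 by (simp_all add: div_Suc mod_Suc)
    have "[r ^ (n div p) * (r * c) = r ^ (n div p) * (c + (p - 1))] (mod p)"
      using turn by (rule cong_scalar_left)
    then have "snd (F (n + 1)) = snd (F n)"
      using True d by (simp add: F_def cong_def mult_ac)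
    moreover have "fst (F (n + 1)) = (fst (F n) + 1) mod k"
      using d by (simp add: F_def mod_simps)
    ultimately have "{(fst (F n), snd (F n)), (fst (F (n + 1)), snd (F (n + 1)))} \<in> edges ?X"
      using F_in[of n] F_in[of "n + 1"] by (subst edge_X_graph_iff) (auto simp: mem_Times_iff)
    then show ?thesis by simp
  next
    case False
    then have d: "(n + 1) div p = n div p" "(n + 1) mod p = n mod p + 1"
      using p0 by (auto simp: div_Suc mod_Suc)
    have "[r ^ (n div p mod k) = r ^ (n div p)] (mod p)"
    proof -
      have "[r ^ (k * (n div p div k)) * r ^ (n div p mod k) = 1 * r ^ (n div p mod k)] (mod p)"
        using rpow by (rule cong_scalar_right)
      then show ?thesis by (simp add: cong_sym_eq flip: power_add)
    qed
    then have "(r ^ (n div p) * (c + n mod p) + r ^ (n div p mod k)) mod p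
        = (r ^ (n div p) * (c + n mod p) + r ^ (n div p)) mod p"
      by (metis cong_add_lcancel_nat cong_def)
    then have "snd (F (n + 1)) = (snd (F n) + r ^ fst (F n)) mod p"
      unfolding F_def d by (simp add: mod_simps algebra_simps)
    moreover have "fst (F (n + 1)) = fst (F n)" using d by (simp add: F_def)
    ultimately have "{(fst (F n), snd (F n)), (fst (F (n + 1)), snd (F (n + 1)))} \<in> edges ?X"
      using F_in[of n] F_in[of "n + 1"] by (subst edge_X_graph_iff) (auto simp: mem_Times_iff)
    then show ?thesis by simp
  qed
  have len: "length C = N" by (simp add: C_def)
  have nth: "C ! (n mod N) = F n" for n using N0 F_mod[of n] by (simp add: C_def)
  have "hamilton_cycle ?X C"
    unfolding hamilton_cycle_def
  proof (intro conjI allI impI)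
    show "distinct C" using \<open>inj_on F {0..<N}\<close> by (simp add: C_def distinct_map)
    show "set C = verts ?X" using F_onto by (simp add: C_def)
    have "2 * 2 \<le> k * p" using k kp by (intro mult_mono) auto
    then show "3 \<le> length C" unfolding len N_def by simp
    fix i assume "i < length C"
    then show "{C ! i, C ! ((i + 1) mod length C)} \<in> edges ?X"
      using nth[of i] nth[of "i + 1"] F_edge[of i] len by simp
  qed
  moreover have "symmetric_cycle ?X C k"
    unfolding symmetric_cycle_def
  proof (intro conjI exI[of _ "layer_shift k p r"] allI impI)
    show "k > 0" using k by simp
    show "k dvd length C" unfolding len N_def by simp
    show "automorphism ?X (layer_shift k p r)"
      using automorphism_layer_shift[OF _ p0 r rk] k by simp
    fix i assume i: "i < length C"
    have "layer_shift k p r (F i) = F (i + p)"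
      using p0 by (simp add: layer_shift_def F_def mod_simps mult_ac)
    then show "layer_shift k p r (C ! i) = C ! ((i + length C div k) mod length C)"
      using nth[of i] nth[of "i + p"] i k len by (simp add: N_def)
  qed
  ultimately show thesis by (rule that)
qed

section \<open>The Hamilton compression\<close>

theorem theorem2p2:
  fixes k p r :: nat
  assumes "k \<ge> 2" and "prime p" and "[p = 1] (mod k)"
    and "coprime r p" and "ord p r = k"
  shows "hamilton_compression (X_graph k p r) = k"
proof -
  let ?X = "X_graph k p r"
  have p1: "p > 1" using assms(2) prime_gt_1_nat by blast
  then have "k dvd p - 1" using assms(3) by (simp add: cong_altdef_nat cong_sym_eq)
  then have kp: "k < p" using p1 dvd_imp_le[of k "p - 1"] by simp
  have le: "l \<le> k" if "hamilton_cycle ?X C" "symmetric_cycle ?X C l" for C l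
    using symmetry_order_le[OF assms(1,2) kp assms(4)] that by blast
  have fin: "finite {l. symmetric_cycle ?X C l}" if "hamilton_cycle ?X C" for C
    using le[OF that] by (auto intro: finite_subset[OF _ finite_atMost[of k]])
  have factor_le: "compression_factor ?X C \<le> k" if C: "hamilton_cycle ?X C" for C
  proof -
    have "automorphism ?X id"
      unfolding automorphism_def by (intro conjI ballI) (simp_all only: bij_betw_id id_apply)
    then have "symmetric_cycle ?X C 1"
      unfolding symmetric_cycle_def by (intro conjI exI[of _ id] allI impI) simp_all
    then show ?thesis
      unfolding compression_factor_def using le[OF C] fin[OF C] by (subst Max_le_iff) auto
  qed
  obtain C where C: "hamilton_cycle ?X C" "symmetric_cycle ?X C k"
    using exists_symmetric_hamilton_cycle[OF assms(1,2) kp assms(4,5)] by blast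
  have "k \<le> compression_factor ?X C"
    unfolding compression_factor_def using fin[OF C(1)] C(2) by (intro Max_ge) auto
  then have "compression_factor ?X C = k" using factor_le[OF C(1)] by simp
  then have "Max {compression_factor ?X C | C. hamilton_cycle ?X C} = k"
  proof (intro Max_eqI)
    have "{compression_factor ?X C | C. hamilton_cycle ?X C} \<subseteq> {..k}" using factor_le by auto
    then show "finite {compression_factor ?X C | C. hamilton_cycle ?X C}"
      by (rule finite_subset) simp
    show "k \<in> {compression_factor ?X C | C. hamilton_cycle ?X C}"
      using C(1) \<open>compression_factor ?X C = k\<close> by (intro CollectI exI[of _ C]) simp
  qed (use factor_le in auto)
  then show ?thesis using C(1) unfolding hamilton_compression_def by auto
qed

end
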